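(* For all integers $m,n,m',n'\ge 0$, the following identities hold (as functions of $(z,w)\in\mathbb{C}^2$): $$H_{m,n,m',n'}=(\xi^*-A_{\widetilde{\xi}})^{m'}(\widetilde{\xi}-A_{\xi^*})^{n'}H_{m,n,0,0},$$ $$H_{m,n,m',n'}=(\xi-A_{\overline{\xi}})^{m}(\overline{\xi}-A_{\xi})^{n}H_{0,0,m',n'},$$ $$H_{m,n,m',n'}=(\xi-A_{\overline{\xi}})^{m}(\overline{\xi}-A_{\xi})^{n}(\xi^*-A_{\widetilde{\xi}})^{m'}(\widetilde{\xi}-A_{\xi^*})^{n'}\cdot(1),$$ $$H_{m,n,m',n'}=(\xi-A_{\overline{\xi}})^{m}(\xi^*-A_{\widetilde{\xi}})^{m'}\left(\overline{\xi}^{\,n}\,\widetilde{\xi}^{\,n'}\right),$$ $$H_{m,n,m',n'}=(\overline{\xi}-A_{\xi})^{n}(\widetilde{\xi}-A_{\xi^*})^{n'}\left(\xi^{m}(\xi^* )^{m'}\right).$$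
   Context: For integers $m,n\ge 0$ and $\zeta\in\mathbb{C}$, $H_{m,n}(\zeta,\overline{\zeta})=(-1)^{m+n}e^{|\zeta|^2}\frac{\partial^{m+n}}{\partial\overline{\zeta}^{m}\partial\zeta^{n}}\left(e^{-|\zeta|^2}\right)$ (Wirtinger derivatives). For $(z,w)\in\mathbb{C}^2$ set $\xi=z+iw$, $\overline{\xi}=\overline{z}-i\overline{w}$, $\xi^*=\overline{z}+i\overline{w}$, $\widetilde{\xi}=z-iw$, and define $H_{m,n,m',n'}(z,w)=H_{m,n}(\xi,\overline{\xi})\,H_{m',n'}(\xi^*,\widetilde{\xi})$. The first order differential operators are $A_{\xi}=\frac12\left(\frac{\partial}{\partial z}-i\frac{\partial}{\partial w}\right)$, $A_{\xi^*}=\frac12\left(\frac{\partial}{\partial\overline{z}}-i\frac{\partial}{\partial\overline{w}}\right)$, $A_{\overline{\xi}}=\frac12\left(\frac{\partial}{\partial\overline{z}}+i\frac{\partial}{\partial\overline{w}}\right)$, $A_{\widetilde{\xi}}=\frac12\left(\frac{\partial}{\partial z}+i\frac{\partial}{\partial w}\right)$. In an expression such as $\xi-A_{\overline{\xi}}$, the symbol $\xi$ denotes the operator of multiplication by $\xi$ (and similarly for the others); $(\cdots)\cdot(1)$ means the operator applied to the constant function $1$. *)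

theory Defs
  imports "HOL-Analysis.Analysis"
begin

text \<open>Wirtinger derivatives, with \<open>\<zeta> = x + \<i> y\<close>:
  \<open>\<partial>/\<partial>\<zeta> = (\<partial>/\<partial>x - \<i> \<partial>/\<partial>y) / 2\<close> and \<open>\<partial>/\<partial>\<zeta>\<^bold>- = (\<partial>/\<partial>x + \<i> \<partial>/\<partial>y) / 2\<close>
  (writing \<open>\<zeta>\<^bold>-\<close> for the conjugate).  They are total operators on functions; at a point where
  a real partial derivative does not exist, the value is unspecified.\<close>

definition partial_x :: "(complex \<Rightarrow> complex) \<Rightarrow> complex \<Rightarrow> complex" where
  "partial_x f \<zeta> = vector_derivative (\<lambda>t::real. f (\<zeta> + complex_of_real t)) (at 0)"

definition partial_y :: "(complex \<Rightarrow> complex) \<Rightarrow> complex \<Rightarrow> complex" where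
  "partial_y f \<zeta> = vector_derivative (\<lambda>t::real. f (\<zeta> + \<i> * complex_of_real t)) (at 0)"

definition wirtinger :: "(complex \<Rightarrow> complex) \<Rightarrow> complex \<Rightarrow> complex" where
  "wirtinger f \<zeta> = (partial_x f \<zeta> - \<i> * partial_y f \<zeta>) / 2"

definition wirtinger_cnj :: "(complex \<Rightarrow> complex) \<Rightarrow> complex \<Rightarrow> complex" where
  "wirtinger_cnj f \<zeta> = (partial_x f \<zeta> + \<i> * partial_y f \<zeta>) / 2"

text \<open>The polynomial usually written \<open>H\<^sub>m\<^sub>,\<^sub>n(\<zeta>, \<zeta>\<^bold>-)\<close>.  As the second argument is always the
  conjugate of the first, it is a function of \<open>\<zeta>\<close> alone here.\<close>

definition hermite_H :: "nat \<Rightarrow> nat \<Rightarrow> complex \<Rightarrow> complex" where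
  "hermite_H m n \<zeta> =
     (-1) ^ (m + n) * complex_of_real (exp ((cmod \<zeta>)\<^sup>2)) *
     (wirtinger_cnj ^^ m) ((wirtinger ^^ n) (\<lambda>\<eta>. complex_of_real (exp (- (cmod \<eta>)\<^sup>2)))) \<zeta>"

type_synonym fun2 = "complex \<times> complex \<Rightarrow> complex"

definition xi :: fun2 where
  "xi = (\<lambda>(z, w). z + \<i> * w)"

definition xi_bar :: fun2 where
  "xi_bar = (\<lambda>(z, w). cnj z - \<i> * cnj w)"

definition xi_star :: fun2 where
  "xi_star = (\<lambda>(z, w). cnj z + \<i> * cnj w)"

definition xi_tilde :: fun2 where
  "xi_tilde = (\<lambda>(z, w). z - \<i> * w)"

text \<open>The pairs of arguments \<open>(\<xi>, \<xi>\<^bold>-)\<close> and \<open>(\<xi>\<^sup>*, \<xi>\<^sup>~)\<close> substituted into the polynomials above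
  are both of the form \<open>(\<zeta>, \<zeta>\<^bold>-)\<close>.\<close>

lemma xi_bar_eq_cnj: "xi_bar p = cnj (xi p)"
  by (cases p) (simp add: xi_def xi_bar_def)

lemma xi_tilde_eq_cnj: "xi_tilde p = cnj (xi_star p)"
  by (cases p) (simp add: xi_star_def xi_tilde_def)

definition hermite_H4 :: "nat \<Rightarrow> nat \<Rightarrow> nat \<Rightarrow> nat \<Rightarrow> fun2" where
  "hermite_H4 m n m' n' p = hermite_H m n (xi p) * hermite_H m' n' (xi_star p)"

definition d_z :: "fun2 \<Rightarrow> fun2" where
  "d_z F = (\<lambda>(z, w). wirtinger (\<lambda>\<zeta>. F (\<zeta>, w)) z)"

definition d_zbar :: "fun2 \<Rightarrow> fun2" where
  "d_zbar F = (\<lambda>(z, w). wirtinger_cnj (\<lambda>\<zeta>. F (\<zeta>, w)) z)"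

definition d_w :: "fun2 \<Rightarrow> fun2" where
  "d_w F = (\<lambda>(z, w). wirtinger (\<lambda>\<zeta>. F (z, \<zeta>)) w)"

definition d_wbar :: "fun2 \<Rightarrow> fun2" where
  "d_wbar F = (\<lambda>(z, w). wirtinger_cnj (\<lambda>\<zeta>. F (z, \<zeta>)) w)"

definition A_xi :: "fun2 \<Rightarrow> fun2" where
  "A_xi F = (\<lambda>p. (d_z F p - \<i> * d_w F p) / 2)"

definition A_xi_star :: "fun2 \<Rightarrow> fun2" where
  "A_xi_star F = (\<lambda>p. (d_zbar F p - \<i> * d_wbar F p) / 2)"

definition A_xi_bar :: "fun2 \<Rightarrow> fun2" where
  "A_xi_bar F = (\<lambda>p. (d_zbar F p + \<i> * d_wbar F p) / 2)"

definition A_xi_tilde :: "fun2 \<Rightarrow> fun2" where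
  "A_xi_tilde F = (\<lambda>p. (d_z F p + \<i> * d_w F p) / 2)"

text \<open>\<open>a \<ominus> A\<close> is the operator "multiplication by \<open>a\<close>, minus \<open>A\<close>".\<close>

definition mult_minus :: "fun2 \<Rightarrow> (fun2 \<Rightarrow> fun2) \<Rightarrow> fun2 \<Rightarrow> fun2"  (infixl "\<ominus>" 65) where
  "(a \<ominus> A) F = (\<lambda>p. a p * F p - A F p)"

end

theory Submission
  imports Defs
begin

text \<open>Conjugating \<open>-\<partial>/\<partial>\<zeta>\<close> and its barred companion by the Gaussian turns them into the raising
  operators \<open>cnj \<zeta> - \<partial>/\<partial>\<zeta>\<close> and \<open>\<zeta> - \<partial>/\<partial>(cnj \<zeta>)\<close>, so the one-variable polynomials arise from
  the constant \<open>1\<close> by iterated raising; the two operators commute because mixed Wirtinger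
  derivatives of polynomials do.  On \<open>\<complex>\<^sup>2\<close> the operators \<open>A\<close> are the partial derivatives in the
  independent coordinates \<open>xi, xi_bar, xi_star, xi_tilde\<close>, so each first order operator acts on
  one factor of \<open>f (xi p) * g (xi_star p)\<close> only.\<close>

text \<open>Every real-linear map of the plane is \<open>a * h + b * cnj h\<close> for unique
  \<open>a\<close> and \<open>b\<close>. Tying both Wirtinger derivatives to the total derivative
  yields genuine sum, product and chain rules, which the total operators alone do not
  provide.\<close>

definition has_wirtinger ::
    "(complex \<Rightarrow> complex) \<Rightarrow> complex \<Rightarrow> complex \<Rightarrow> complex \<Rightarrow> bool" where
  "has_wirtinger f a b \<zeta> \<longleftrightarrow> (f has_derivative (\<lambda>h. a * h + b * cnj h)) (at \<zeta>)"

text \<open>Conjugating \<open>c * h + d * cnj h\<close> exchanges the roles of \<open>h\<close> and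
  \<open>cnj h\<close>, which is why \<open>cnj d\<close> and \<open>cnj c\<close> go with
  \<open>b\<close>.\<close>

lemma has_wirtinger_chain:
  assumes "has_wirtinger f a b (g \<zeta>)" "has_wirtinger g c d \<zeta>"
  shows "has_wirtinger (\<lambda>\<eta>. f (g \<eta>)) (a * c + b * cnj d) (a * d + b * cnj c) \<zeta>"
  using has_derivative_compose[OF assms(2)[unfolded has_wirtinger_def] assms(1)[unfolded has_wirtinger_def]]
  unfolding has_wirtinger_def by (rule has_derivative_eq_rhs) (auto simp: algebra_simps)

lemma has_vector_derivative_along:
  assumes "has_wirtinger f a b \<zeta>"
  shows "((\<lambda>t::real. f (\<zeta> + u * of_real t)) has_vector_derivative (a * u + b * cnj u)) (at 0)"
proof -
  have "((\<lambda>t::real. \<zeta> + u * of_real t) has_derivative (\<lambda>t. u * of_real t)) (at 0)"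
    by (auto intro!: derivative_eq_intros)
  then have "((\<lambda>t::real. f (\<zeta> + u * of_real t)) has_derivative
      (\<lambda>t. a * (u * of_real t) + b * cnj (u * of_real t))) (at 0)"
    using assms unfolding has_wirtinger_def
    by (intro has_derivative_compose[where f="\<lambda>t::real. \<zeta> + u * of_real t" and g=f]) auto
  then show ?thesis
    unfolding has_vector_derivative_def
    by (rule has_derivative_eq_rhs) (auto simp: algebra_simps scaleR_conv_of_real)
qed

text \<open>The directions \<open>1\<close> and \<open>\<i>\<close> give the partials
  \<open>a + b\<close> and \<open>\<i> * (a - b)\<close>, and these determine \<open>a\<close> and
  \<open>b\<close>.\<close>

lemma
  assumes "has_wirtinger f a b \<zeta>"
  shows wirtinger_eqI: "wirtinger f \<zeta> = a"
    and wirtinger_cnj_eqI: "wirtinger_cnj f \<zeta> = b"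
proof -
  have "partial_x f \<zeta> = a + b"
    using has_vector_derivative_along[OF assms, of 1]
    unfolding partial_x_def by (simp add: vector_derivative_at)
  moreover have "partial_y f \<zeta> = \<i> * a - \<i> * b"
    using has_vector_derivative_along[OF assms, of \<i>]
    unfolding partial_y_def by (simp add: vector_derivative_at algebra_simps)
  ultimately show "wirtinger f \<zeta> = a" "wirtinger_cnj f \<zeta> = b"
    by (simp_all add: wirtinger_def wirtinger_cnj_def right_diff_distrib)
qed

lemma has_wirtinger_const: "has_wirtinger (\<lambda>_. c) 0 0 \<zeta>"
  by (simp add: has_wirtinger_def)

lemma has_wirtinger_ident: "has_wirtinger (\<lambda>\<eta>. \<eta>) 1 0 \<zeta>"
  by (simp add: has_wirtinger_def)

lemma has_wirtinger_cnj: "has_wirtinger cnj 0 1 \<zeta>"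
  by (simp add: has_wirtinger_def bounded_linear_imp_has_derivative bounded_linear_cnj)

lemma has_wirtinger_add:
  assumes "has_wirtinger f a b \<zeta>" "has_wirtinger g c d \<zeta>"
  shows "has_wirtinger (\<lambda>\<eta>. f \<eta> + g \<eta>) (a + c) (b + d) \<zeta>"
  using has_derivative_add[OF assms[unfolded has_wirtinger_def]]
  unfolding has_wirtinger_def by (rule has_derivative_eq_rhs) (auto simp: algebra_simps)

lemma has_wirtinger_mult:
  assumes "has_wirtinger f a b \<zeta>" "has_wirtinger g c d \<zeta>"
  shows "has_wirtinger (\<lambda>\<eta>. f \<eta> * g \<eta>) (a * g \<zeta> + f \<zeta> * c) (b * g \<zeta> + f \<zeta> * d) \<zeta>"
  using has_derivative_mult[OF assms[unfolded has_wirtinger_def]]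
  unfolding has_wirtinger_def by (rule has_derivative_eq_rhs) (auto simp: algebra_simps)

abbreviation gauss :: "complex \<Rightarrow> complex" where
  "gauss \<equiv> \<lambda>\<eta>. complex_of_real (exp (- (cmod \<eta>)\<^sup>2))"

text \<open>Written as \<open>exp (- \<eta> * cnj \<eta>)\<close>, the Gaussian falls under the
  chain rule; \<open>exp\<close> is holomorphic, so its second coefficient is
  \<open>0\<close>.\<close>

lemma has_wirtinger_gauss:
  "has_wirtinger gauss (- cnj \<zeta> * gauss \<zeta>) (- \<zeta> * gauss \<zeta>) \<zeta>"
proof -
  have gauss_eq: "gauss \<eta> = exp (- 1 * (\<eta> * cnj \<eta>))" for \<eta>
    by (simp flip: complex_norm_square exp_of_real)
  have "has_wirtinger exp (exp z) 0 z" for z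
    using DERIV_exp[of z] by (simp add: has_wirtinger_def has_field_derivative_def)
  from has_wirtinger_chain[OF this, OF has_wirtinger_mult[OF has_wirtinger_const
        has_wirtinger_mult[OF has_wirtinger_ident has_wirtinger_cnj]], of "- 1" \<zeta>]
  show ?thesis unfolding gauss_eq by (simp add: mult.commute)
qed

section \<open>Polynomials in a complex variable and its conjugate\<close>

text \<open>Generation by sums and products lets differentiability, closure under both derivatives
  and their commutation all be proved by structural induction.\<close>

inductive_set bipoly :: "(complex \<Rightarrow> complex) set" where
  const: "(\<lambda>_. c) \<in> bipoly"
| ident: "(\<lambda>\<zeta>. \<zeta>) \<in> bipoly"
| cnj: "cnj \<in> bipoly"
| add: "f \<in> bipoly \<Longrightarrow> g \<in> bipoly \<Longrightarrow> (\<lambda>\<zeta>. f \<zeta> + g \<zeta>) \<in> bipoly"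
| mult: "f \<in> bipoly \<Longrightarrow> g \<in> bipoly \<Longrightarrow> (\<lambda>\<zeta>. f \<zeta> * g \<zeta>) \<in> bipoly"

lemma bipoly_diff:
  assumes "f \<in> bipoly" "g \<in> bipoly"
  shows "(\<lambda>\<zeta>. f \<zeta> - g \<zeta>) \<in> bipoly"
  using bipoly.add[OF assms(1) bipoly.mult[OF bipoly.const assms(2), of "- 1"]] by simp

lemma has_wirtinger_bipoly:
  assumes "f \<in> bipoly"
  shows "has_wirtinger f (wirtinger f \<zeta>) (wirtinger_cnj f \<zeta>) \<zeta>"
proof -
  have "\<exists>a b. has_wirtinger f a b \<zeta>"
    using assms
    by induction (blast intro: has_wirtinger_const has_wirtinger_ident has_wirtinger_cnj
        has_wirtinger_add has_wirtinger_mult)+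
  then show ?thesis using wirtinger_eqI wirtinger_cnj_eqI by blast
qed

lemma wirtinger_simps [simp]:
  "wirtinger (\<lambda>_. c) = (\<lambda>_. 0)" "wirtinger_cnj (\<lambda>_. c) = (\<lambda>_. 0)"
  "wirtinger (\<lambda>\<zeta>. \<zeta>) = (\<lambda>_. 1)" "wirtinger_cnj (\<lambda>\<zeta>. \<zeta>) = (\<lambda>_. 0)"
  "wirtinger cnj = (\<lambda>_. 0)" "wirtinger_cnj cnj = (\<lambda>_. 1)"
  using has_wirtinger_const has_wirtinger_ident has_wirtinger_cnj
  by (blast intro: wirtinger_eqI wirtinger_cnj_eqI)+

lemma
  assumes "f \<in> bipoly" "g \<in> bipoly"
  shows wirtinger_add: "wirtinger (\<lambda>\<zeta>. f \<zeta> + g \<zeta>) = (\<lambda>\<zeta>. wirtinger f \<zeta> + wirtinger g \<zeta>)"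
    and wirtinger_cnj_add:
      "wirtinger_cnj (\<lambda>\<zeta>. f \<zeta> + g \<zeta>) = (\<lambda>\<zeta>. wirtinger_cnj f \<zeta> + wirtinger_cnj g \<zeta>)"
    and wirtinger_mult:
      "wirtinger (\<lambda>\<zeta>. f \<zeta> * g \<zeta>) = (\<lambda>\<zeta>. wirtinger f \<zeta> * g \<zeta> + f \<zeta> * wirtinger g \<zeta>)"
    and wirtinger_cnj_mult:
      "wirtinger_cnj (\<lambda>\<zeta>. f \<zeta> * g \<zeta>) = (\<lambda>\<zeta>. wirtinger_cnj f \<zeta> * g \<zeta> + f \<zeta> * wirtinger_cnj g \<zeta>)"
  using has_wirtinger_add[OF assms[THEN has_wirtinger_bipoly]]
    has_wirtinger_mult[OF assms[THEN has_wirtinger_bipoly]]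
  by (blast intro: wirtinger_eqI wirtinger_cnj_eqI)+

lemma
  assumes "f \<in> bipoly" "g \<in> bipoly"
  shows wirtinger_diff: "wirtinger (\<lambda>\<zeta>. f \<zeta> - g \<zeta>) = (\<lambda>\<zeta>. wirtinger f \<zeta> - wirtinger g \<zeta>)"
    and wirtinger_cnj_diff:
      "wirtinger_cnj (\<lambda>\<zeta>. f \<zeta> - g \<zeta>) = (\<lambda>\<zeta>. wirtinger_cnj f \<zeta> - wirtinger_cnj g \<zeta>)"
  using wirtinger_add[OF assms(1) bipoly.mult[OF bipoly.const assms(2), of "- 1"]]
    wirtinger_cnj_add[OF assms(1) bipoly.mult[OF bipoly.const assms(2), of "- 1"]]
    wirtinger_mult[OF bipoly.const assms(2), of "- 1"]
    wirtinger_cnj_mult[OF bipoly.const assms(2), of "- 1"]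
  by simp_all

lemma
  assumes "f \<in> bipoly"
  shows wirtinger_bipoly: "wirtinger f \<in> bipoly"
    and wirtinger_cnj_bipoly: "wirtinger_cnj f \<in> bipoly"
  using assms
  by (induction f)
    (auto simp: wirtinger_add wirtinger_cnj_add wirtinger_mult wirtinger_cnj_mult intro: bipoly.intros)

text \<open>No theorem on mixed partials is invoked: on generators both sides vanish, and on a
  product the Leibniz rule gives the same four terms in either order.\<close>

lemma wirtinger_commute:
  assumes "f \<in> bipoly"
  shows "wirtinger (wirtinger_cnj f) = wirtinger_cnj (wirtinger f)"
  using assms
proof induction
  case (add f g)
  then show ?case
    by (simp add: wirtinger_add wirtinger_cnj_add wirtinger_bipoly wirtinger_cnj_bipoly)
next
  case (mult f g)
  then show ?case
    by (simp add: wirtinger_add wirtinger_cnj_add wirtinger_mult wirtinger_cnj_mult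
        wirtinger_bipoly wirtinger_cnj_bipoly bipoly.mult algebra_simps)
qed simp_all

section \<open>Raising operators\<close>

definition raise_fst :: "(complex \<Rightarrow> complex) \<Rightarrow> complex \<Rightarrow> complex" where
  "raise_fst f = (\<lambda>\<zeta>. \<zeta> * f \<zeta> - wirtinger_cnj f \<zeta>)"

definition raise_snd :: "(complex \<Rightarrow> complex) \<Rightarrow> complex \<Rightarrow> complex" where
  "raise_snd f = (\<lambda>\<zeta>. cnj \<zeta> * f \<zeta> - wirtinger f \<zeta>)"

lemma
  assumes "f \<in> bipoly"
  shows raise_fst_bipoly: "raise_fst f \<in> bipoly"
    and raise_snd_bipoly: "raise_snd f \<in> bipoly"
  unfolding raise_fst_def raise_snd_def
  using assms by (auto intro!: bipoly_diff bipoly.intros wirtinger_bipoly wirtinger_cnj_bipoly)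

lemma
  assumes "f \<in> bipoly"
  shows raise_fst_funpow_bipoly: "(raise_fst ^^ k) f \<in> bipoly"
    and raise_snd_funpow_bipoly: "(raise_snd ^^ k) f \<in> bipoly"
  using assms by (induction k) (auto intro: raise_fst_bipoly raise_snd_bipoly)

text \<open>Both orders produce the same extra term \<open>- f\<close>, once from differentiating
  \<open>cnj \<zeta>\<close> and once from \<open>\<zeta>\<close>; the second order terms agree by
  \<open>wirtinger_commute\<close>.\<close>

lemma raise_commute:
  assumes "f \<in> bipoly"
  shows "raise_fst (raise_snd f) = raise_snd (raise_fst f)"
  using assms unfolding raise_fst_def raise_snd_def
  by (simp add: wirtinger_diff wirtinger_cnj_diff wirtinger_mult wirtinger_cnj_mult wirtinger_commute
      wirtinger_bipoly wirtinger_cnj_bipoly bipoly.intros algebra_simps)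

lemma raise_fst_snd_funpow_commute:
  assumes "f \<in> bipoly"
  shows "raise_fst ((raise_snd ^^ n) f) = (raise_snd ^^ n) (raise_fst f)"
  using assms by (induction n) (simp_all add: raise_commute raise_snd_funpow_bipoly)

lemma raise_funpow_commute:
  assumes "f \<in> bipoly"
  shows "(raise_fst ^^ m) ((raise_snd ^^ n) f) = (raise_snd ^^ n) ((raise_fst ^^ m) f)"
  using assms by (induction m) (simp_all add: raise_fst_snd_funpow_commute raise_fst_funpow_bipoly)

lemma power_bipoly: "(\<lambda>\<zeta>. \<zeta> ^ k) \<in> bipoly" "(\<lambda>\<zeta>. cnj \<zeta> ^ k) \<in> bipoly"
  by (induction k) (auto intro: bipoly.intros)

lemma wirtinger_cnj_power: "wirtinger_cnj (\<lambda>\<zeta>. \<zeta> ^ k) = (\<lambda>_. 0)"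
  by (induction k) (simp_all add: wirtinger_cnj_mult bipoly.intros power_bipoly)

lemma wirtinger_power_cnj: "wirtinger (\<lambda>\<zeta>. cnj \<zeta> ^ k) = (\<lambda>_. 0)"
  by (induction k) (simp_all add: wirtinger_mult bipoly.intros power_bipoly)

text \<open>On holomorphic powers the derivative term vanishes, so raising is plain multiplication.
  This accounts for the monomials in the last two identities.\<close>

lemma raise_fst_funpow_one: "(raise_fst ^^ k) (\<lambda>_. 1) = (\<lambda>\<zeta>. \<zeta> ^ k)"
  by (induction k) (simp_all add: raise_fst_def wirtinger_cnj_power)

lemma raise_snd_funpow_one: "(raise_snd ^^ k) (\<lambda>_. 1) = (\<lambda>\<zeta>. cnj \<zeta> ^ k)"
  by (induction k) (simp_all add: raise_snd_def wirtinger_power_cnj)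

text \<open>The free factor \<open>c\<close> absorbs the sign that each differentiation contributes,
  so the rule can be iterated.\<close>

lemma
  assumes "f \<in> bipoly"
  shows wirtinger_gauss_mult:
      "wirtinger (\<lambda>\<eta>. c * gauss \<eta> * f \<eta>) = (\<lambda>\<eta>. - c * gauss \<eta> * raise_snd f \<eta>)"
    and wirtinger_cnj_gauss_mult:
      "wirtinger_cnj (\<lambda>\<eta>. c * gauss \<eta> * f \<eta>) = (\<lambda>\<eta>. - c * gauss \<eta> * raise_fst f \<eta>)"
proof -
  have *: "has_wirtinger (\<lambda>\<eta>. c * gauss \<eta> * f \<eta>)
      (- c * gauss \<zeta> * raise_snd f \<zeta>) (- c * gauss \<zeta> * raise_fst f \<zeta>) \<zeta>" for \<zeta>
    using has_wirtinger_mult[OF has_wirtinger_mult[OF has_wirtinger_const has_wirtinger_gauss]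
        has_wirtinger_bipoly[OF assms], of c \<zeta>]
    by (simp add: raise_snd_def raise_fst_def algebra_simps)
  show "wirtinger (\<lambda>\<eta>. c * gauss \<eta> * f \<eta>) = (\<lambda>\<eta>. - c * gauss \<eta> * raise_snd f \<eta>)"
    and "wirtinger_cnj (\<lambda>\<eta>. c * gauss \<eta> * f \<eta>) = (\<lambda>\<eta>. - c * gauss \<eta> * raise_fst f \<eta>)"
    using *[THEN wirtinger_eqI] *[THEN wirtinger_cnj_eqI] by blast+
qed

lemma
  assumes "f \<in> bipoly"
  shows wirtinger_funpow_gauss_mult: "(wirtinger ^^ k) (\<lambda>\<eta>. c * gauss \<eta> * f \<eta>) =
      (\<lambda>\<eta>. (- 1) ^ k * c * gauss \<eta> * (raise_snd ^^ k) f \<eta>)"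
    and wirtinger_cnj_funpow_gauss_mult: "(wirtinger_cnj ^^ k) (\<lambda>\<eta>. c * gauss \<eta> * f \<eta>) =
      (\<lambda>\<eta>. (- 1) ^ k * c * gauss \<eta> * (raise_fst ^^ k) f \<eta>)"
  by (induction k)
    (simp_all add: wirtinger_gauss_mult wirtinger_cnj_gauss_mult assms
      raise_fst_funpow_bipoly raise_snd_funpow_bipoly del: of_real_exp of_real_minus)

lemma hermite_H_eq: "hermite_H m n = (raise_fst ^^ m) ((raise_snd ^^ n) (\<lambda>_. 1))"
proof
  fix \<zeta>
  have "(wirtinger ^^ n) gauss = (\<lambda>\<eta>. (- 1) ^ n * gauss \<eta> * (raise_snd ^^ n) (\<lambda>_. 1) \<eta>)"
    using wirtinger_funpow_gauss_mult[OF bipoly.const, of n 1 1] by simp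
  then have "(wirtinger_cnj ^^ m) ((wirtinger ^^ n) gauss) \<zeta> =
      (- 1) ^ (m + n) * gauss \<zeta> * (raise_fst ^^ m) ((raise_snd ^^ n) (\<lambda>_. 1)) \<zeta>"
    \<comment> \<open>The constant \<open>(- 1) ^ n\<close> is the sign left by the \<open>n\<close>
      inner derivatives; the total sign and the Gaussian then cancel against the prefactor of
      \<open>hermite_H\<close>.\<close>
    using wirtinger_cnj_funpow_gauss_mult[OF raise_snd_funpow_bipoly[OF bipoly.const], of m "(- 1) ^ n" n 1]
    by (simp add: power_add)
  moreover have "complex_of_real (exp ((cmod \<zeta>)\<^sup>2)) * gauss \<zeta> = 1"
    by (simp flip: of_real_mult exp_add)
  moreover have "(- 1) ^ (m + n) * (- 1) ^ (m + n) = (1 :: complex)"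
    by (simp flip: power_add)
  ultimately show "hermite_H m n \<zeta> = (raise_fst ^^ m) ((raise_snd ^^ n) (\<lambda>_. 1)) \<zeta>"
    unfolding hermite_H_def by (smt (verit) mult.assoc mult.commute mult_1)
qed

section \<open>Functions of two variables\<close>

definition tensor :: "(complex \<Rightarrow> complex) \<Rightarrow> (complex \<Rightarrow> complex) \<Rightarrow> fun2" where
  "tensor f g p = f (xi p) * g (xi_star p)"

context
  fixes f g :: "complex \<Rightarrow> complex"
  assumes f: "f \<in> bipoly" and g: "g \<in> bipoly"
begin

text \<open>In \<open>z\<close>, \<open>xi\<close> is holomorphic but \<open>xi_star\<close> is
  antiholomorphic, so the two derivatives of \<open>g\<close> change places.\<close>

lemma has_wirtinger_tensor_z:
  "has_wirtinger (\<lambda>\<zeta>. tensor f g (\<zeta>, w))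
    (tensor (wirtinger f) g (z, w) + tensor f (wirtinger_cnj g) (z, w))
    (tensor (wirtinger_cnj f) g (z, w) + tensor f (wirtinger g) (z, w)) z"
proof -
  note fst = has_wirtinger_chain[OF has_wirtinger_bipoly[OF f]
      has_wirtinger_add[OF has_wirtinger_ident has_wirtinger_const], of "\<i> * w" z]
  note snd = has_wirtinger_chain[OF has_wirtinger_bipoly[OF g]
      has_wirtinger_add[OF has_wirtinger_cnj has_wirtinger_const], of "\<i> * cnj w" z]
  from has_wirtinger_mult[OF fst snd] show ?thesis
    by (simp add: tensor_def xi_def xi_star_def)
qed

text \<open>As for \<open>z\<close>, except that the coefficient \<open>\<i>\<close> of
  \<open>cnj w\<close> in \<open>xi_star\<close> gets conjugated. The resulting opposite signs are
  what separates the two factors.\<close>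

lemma has_wirtinger_tensor_w:
  "has_wirtinger (\<lambda>\<zeta>. tensor f g (z, \<zeta>))
    (\<i> * (tensor (wirtinger f) g (z, w) - tensor f (wirtinger_cnj g) (z, w)))
    (- \<i> * (tensor (wirtinger_cnj f) g (z, w) - tensor f (wirtinger g) (z, w))) w"
proof -
  note fst = has_wirtinger_chain[OF has_wirtinger_bipoly[OF f] has_wirtinger_add[OF
        has_wirtinger_const has_wirtinger_mult[OF has_wirtinger_const has_wirtinger_ident]], of z \<i> w]
  note snd = has_wirtinger_chain[OF has_wirtinger_bipoly[OF g] has_wirtinger_add[OF
        has_wirtinger_const has_wirtinger_mult[OF has_wirtinger_const has_wirtinger_cnj]],
      of "cnj z" \<i> w]
  from has_wirtinger_mult[OF fst snd] show ?thesis
    by (simp add: tensor_def xi_def xi_star_def algebra_simps)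
qed

lemmas d_tensor =
  has_wirtinger_tensor_z[THEN wirtinger_eqI] has_wirtinger_tensor_z[THEN wirtinger_cnj_eqI]
  has_wirtinger_tensor_w[THEN wirtinger_eqI] has_wirtinger_tensor_w[THEN wirtinger_cnj_eqI]

text \<open>In each half-combination of a \<open>z\<close>- and a \<open>w\<close>-derivative, the
  terms differentiating one factor cancel and those differentiating the other double.\<close>

lemma A_tensor:
  "A_xi (tensor f g) = tensor (wirtinger f) g"
  "A_xi_bar (tensor f g) = tensor (wirtinger_cnj f) g"
  "A_xi_star (tensor f g) = tensor f (wirtinger g)"
  "A_xi_tilde (tensor f g) = tensor f (wirtinger_cnj g)"
  by (auto simp: fun_eq_iff A_xi_def A_xi_bar_def A_xi_star_def A_xi_tilde_def
      d_z_def d_zbar_def d_w_def d_wbar_def d_tensor right_diff_distrib)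

lemma mult_minus_tensor:
  "(xi \<ominus> A_xi_bar) (tensor f g) = tensor (raise_fst f) g"
  "(xi_bar \<ominus> A_xi) (tensor f g) = tensor (raise_snd f) g"
  "(xi_star \<ominus> A_xi_tilde) (tensor f g) = tensor f (raise_fst g)"
  "(xi_tilde \<ominus> A_xi_star) (tensor f g) = tensor f (raise_snd g)"
  by (auto simp: fun_eq_iff mult_minus_def A_tensor tensor_def raise_fst_def raise_snd_def
      xi_bar_eq_cnj xi_tilde_eq_cnj algebra_simps)

end

lemma mult_minus_funpow_tensor:
  assumes "f \<in> bipoly" "g \<in> bipoly"
  shows "((xi \<ominus> A_xi_bar) ^^ k) (tensor f g) = tensor ((raise_fst ^^ k) f) g"
    and "((xi_bar \<ominus> A_xi) ^^ k) (tensor f g) = tensor ((raise_snd ^^ k) f) g"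
    and "((xi_star \<ominus> A_xi_tilde) ^^ k) (tensor f g) = tensor f ((raise_fst ^^ k) g)"
    and "((xi_tilde \<ominus> A_xi_star) ^^ k) (tensor f g) = tensor f ((raise_snd ^^ k) g)"
  using assms
  by (induction k)
    (simp_all add: mult_minus_tensor raise_fst_funpow_bipoly raise_snd_funpow_bipoly)

lemma hermite_H4_eq_tensor: "hermite_H4 m n m' n' = tensor (hermite_H m n) (hermite_H m' n')"
  by (auto simp: fun_eq_iff hermite_H4_def tensor_def)

theorem proposition3p6:
  fixes m n m' n' :: nat
  shows "hermite_H4 m n m' n' =
           ((xi_star \<ominus> A_xi_tilde) ^^ m') (((xi_tilde \<ominus> A_xi_star) ^^ n') (hermite_H4 m n 0 0))
       \<and> hermite_H4 m n m' n' =
           ((xi \<ominus> A_xi_bar) ^^ m) (((xi_bar \<ominus> A_xi) ^^ n) (hermite_H4 0 0 m' n'))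
       \<and> hermite_H4 m n m' n' =
           ((xi \<ominus> A_xi_bar) ^^ m) (((xi_bar \<ominus> A_xi) ^^ n)
             (((xi_star \<ominus> A_xi_tilde) ^^ m') (((xi_tilde \<ominus> A_xi_star) ^^ n') (\<lambda>p. 1))))
       \<and> hermite_H4 m n m' n' =
           ((xi \<ominus> A_xi_bar) ^^ m) (((xi_star \<ominus> A_xi_tilde) ^^ m')
             (\<lambda>p. xi_bar p ^ n * xi_tilde p ^ n'))
       \<and> hermite_H4 m n m' n' =
           ((xi_bar \<ominus> A_xi) ^^ n) (((xi_tilde \<ominus> A_xi_star) ^^ n')
             (\<lambda>p. xi p ^ m * xi_star p ^ m'))"
proof -
  have "(\<lambda>p. 1) = tensor (\<lambda>_. 1) (\<lambda>_. 1)"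
    and "(\<lambda>p. xi_bar p ^ n * xi_tilde p ^ n') = tensor (\<lambda>\<zeta>. cnj \<zeta> ^ n) (\<lambda>\<zeta>. cnj \<zeta> ^ n')"
    and "(\<lambda>p. xi p ^ m * xi_star p ^ m') = tensor (\<lambda>\<zeta>. \<zeta> ^ m) (\<lambda>\<zeta>. \<zeta> ^ m')"
    by (auto simp: tensor_def xi_bar_eq_cnj xi_tilde_eq_cnj)
  \<comment> \<open>Commuting the raising operators is needed for this form, which serves the fifth
    identity; the next form, for the fourth, keeps the original order.\<close>
  moreover have "hermite_H k l = (raise_snd ^^ l) (\<lambda>\<zeta>. \<zeta> ^ k)" for k l
    by (simp add: hermite_H_eq raise_funpow_commute bipoly.const raise_fst_funpow_one)
  moreover have "hermite_H k l = (raise_fst ^^ k) (\<lambda>\<zeta>. cnj \<zeta> ^ l)" for k l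
    by (simp add: hermite_H_eq raise_snd_funpow_one)
  ultimately show ?thesis
    \<comment> \<open>With both indices zero this gives the constant \<open>1\<close>, the untouched
      factor in the first two identities.\<close>
    using hermite_H_eq
    by (simp add: hermite_H4_eq_tensor mult_minus_funpow_tensor power_bipoly bipoly.const
        raise_fst_funpow_bipoly raise_snd_funpow_bipoly)
qed

end
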